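(* None of $\mathrm{Pol}(T_2)$, $T_2$, $T_1\cap T_2$ is countably generated over $\mathcal{O}^{(1)}$. That is: there is no countable set $C\subseteq\mathcal{O}$ such that $\mathrm{Pol}(T_2)$ is the smallest clone containing $C\cup\mathcal{O}^{(1)}$; and for $D=T_2$ and for $D=T_1\cap T_2$ there is no countable set $C\subseteq\mathcal{O}^{(2)}$ such that $D$ is the smallest binary clone containing $C\cup\mathcal{O}^{(1)}$.
   Context: $\mathbb{N}=\{0,1,2,\dots\}$; $\mathcal{O}^{(n)}=\mathbb{N}^{\mathbb{N}^n}$ is the set of all $n$-ary operations on $\mathbb{N}$ ($n\ge1$), and $\mathcal{O}=\bigcup_{n\ge1}\mathcal{O}^{(n)}$. For $f\in\mathcal{O}^{(n)}$ and $g_1,\dots,g_n\in\mathcal{O}^{(k)}$, $f(g_1,\dots,g_n)\in\mathcal{O}^{(k)}$ is defined by $f(g_1,\dots,g_n)(\vec x)=f(g_1(\vec x),\dots,g_n(\vec x))$. A clone is a subset of $\mathcal{O}$ containing all projections and closed under this composition. A binary clone is a subset of $\mathcal{O}^{(2)}$ containing the two binary projections and closed under $(f,g,h)\mapsto f(g,h)$. The set $\mathcal{O}^{(1)}$ of unary functions is identified with the set of essentially unary functions; thus, for binary clones, "containing $\mathcal{O}^{(1)}$" means containing all functions $(x,y)\mapsto u(x)$ and $(x,y)\mapsto u(y)$ with $u:\mathbb{N}\to\mathbb{N}$ arbitrary. For $B\subseteq\mathcal{O}^{(2)}$, $\mathrm{Pol}(B)=\bigcup_{k\ge1}\{f\in\mathcal{O}^{(k)}:\forall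 g_1,\dots,g_k\in B\;\; f(g_1,\dots,g_k)\in B\}$; it is a clone. A function $f:\mathbb{N}\times\mathbb{N}\to\mathbb{N}$ is almost unary if there is $F:\mathbb{N}\to\mathbb{N}$ with $f(x,y)\le F(x)$ for all $x,y$, or there is $F:\mathbb{N}\to\mathbb{N}$ with $f(x,y)\le F(y)$ for all $x,y$. $T_1$ is the set of all almost unary functions; it is a binary clone containing $\mathcal{O}^{(1)}$. Let $\Delta=\{(x,y)\in\mathbb{N}^2:x>y\}$, $\nabla=\{(x,y)\in\mathbb{N}^2:x<y\}$, and for $S_1,S_2\subseteq\mathbb{N}$ let $\Delta_{S_1,S_2}=\Delta\cap(S_1\times S_2)$, $\nabla_{S_1,S_2}=\nabla\cap(S_1\times S_2)$. For infinite $S_1,S_2\subseteq\mathbb{N}$, a function $g:\Delta_{S_1,S_2}\to\mathbb{N}$ or $g:\nabla_{S_1,S_2}\to\mathbb{N}$ is canonical if one of the following holds: (1) $g$ is constant; (2) there is a 1-1 function $G:S_1\to\mathbb{N}$ with $g(x,y)=G(x)$ for all $(x,y)\in\mathrm{dom}(g)$; (3) there is a 1-1 function $G:S_2\to\mathbb{N}$ with $g(x,y)=G(y)$ for all $(x,y)\in\mathrm{dom}(g)$; (4) $g$ is 1-1. A function $f:\mathbb{N}\times\mathbb{N}\to\mathbb{N}$ is canonical on $S_1\times S_2$ (with $S_1,S_2$ infinite) if both restrictions $f|_{\Delta_{S_1,S_2}}$ and $f|_{\nabla_{S_1,S_2}}$ are canonical (not necessarily of the same kind), and moreover either the ranges of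 these two restrictions are disjoint, or $S_1=S_2$ and $f(x,y)=f(y,x)$ for all $x,y\in S_1$. A function $f:\mathbb{N}\times\mathbb{N}\to\mathbb{N}$ is nowhere injective if, whenever $f$ is canonical on $S_1\times S_2$ (for infinite $S_1,S_2$), neither $f|_{\Delta_{S_1,S_2}}$ nor $f|_{\nabla_{S_1,S_2}}$ is 1-1. $T_2$ is the set of all nowhere injective functions; it is a binary clone containing $\mathcal{O}^{(1)}$. *)

theory Defs
  imports HOL.Hull "HOL-Library.FuncSet" "HOL-Library.Countable_Set"
begin

text \<open>An operation carries its arity, so that the sets \<^term>\<open>ops n\<close> are pairwise disjoint; its
  second component is extensional (\<^term>\<open>undefined\<close> off the lists of length \<^term>\<open>n\<close>), so that
  equality of operations is equality of functions on \<open>n\<close>-tuples.\<close>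

type_synonym operation = "nat \<times> (nat list \<Rightarrow> nat)"

definition ops :: "nat \<Rightarrow> operation set" where
  "ops n = {n} \<times> ({xs. length xs = n} \<rightarrow>\<^sub>E UNIV)"

definition all_ops :: "operation set" where
  "all_ops = (\<Union>n\<in>{1..}. ops n)"

definition projection :: "nat \<Rightarrow> nat \<Rightarrow> operation" where
  "projection n i = (n, restrict (\<lambda>xs. xs ! i) {xs. length xs = n})"

definition op_comp :: "nat \<Rightarrow> operation \<Rightarrow> operation list \<Rightarrow> operation" where
  "op_comp k f gs = (k, restrict (\<lambda>xs. snd f (map (\<lambda>g. snd g xs) gs)) {xs. length xs = k})"

definition clone :: "operation set \<Rightarrow> bool" where
  "clone C \<longleftrightarrow>
     C \<subseteq> all_ops \<and>
     (\<forall>n\<ge>1. \<forall>i<n. projection n i \<in> C) \<and>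
     (\<forall>n\<ge>1. \<forall>k\<ge>1. \<forall>f\<in>C \<inter> ops n. \<forall>gs.
        length gs = n \<and> set gs \<subseteq> C \<inter> ops k \<longrightarrow> op_comp k f gs \<in> C)"

text \<open>Binary operations are also taken as plain functions on pairs; this is the form in which
  binary clones are treated.\<close>

type_synonym binop = "nat \<times> nat \<Rightarrow> nat"

definition binary_clone :: "binop set \<Rightarrow> bool" where
  "binary_clone B \<longleftrightarrow>
     fst \<in> B \<and> snd \<in> B \<and> (\<forall>f\<in>B. \<forall>g\<in>B. \<forall>h\<in>B. (\<lambda>p. f (g p, h p)) \<in> B)"

definition binary_unary :: "binop set" where
  "binary_unary = {(\<lambda>(x, y). u x) | u. True} \<union> {(\<lambda>(x, y). u y) | u. True}"

definition Pol :: "binop set \<Rightarrow> operation set" where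
  "Pol B = (\<Union>k\<in>{1..}. {f \<in> ops k. \<forall>gs.
     length gs = k \<and> set gs \<subseteq> B \<longrightarrow> (\<lambda>p. snd f (map (\<lambda>g. g p) gs)) \<in> B})"

definition almost_unary :: "binop \<Rightarrow> bool" where
  "almost_unary f \<longleftrightarrow>
     (\<exists>F :: nat \<Rightarrow> nat. \<forall>x y. f (x, y) \<le> F x) \<or> (\<exists>F :: nat \<Rightarrow> nat. \<forall>x y. f (x, y) \<le> F y)"

definition T1 :: "binop set" where
  "T1 = {f. almost_unary f}"

definition Delta :: "nat set \<Rightarrow> nat set \<Rightarrow> (nat \<times> nat) set" where
  "Delta S1 S2 = {(x, y). x > y} \<inter> S1 \<times> S2"

definition Nabla :: "nat set \<Rightarrow> nat set \<Rightarrow> (nat \<times> nat) set" where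
  "Nabla S1 S2 = {(x, y). x < y} \<inter> S1 \<times> S2"

text \<open>\<open>canonical S1 S2 D g\<close> is about the restriction of \<^term>\<open>g\<close> to \<^term>\<open>D\<close>, which is meant to be
  \<^term>\<open>Delta S1 S2\<close> or \<^term>\<open>Nabla S1 S2\<close>.\<close>

definition canonical :: "nat set \<Rightarrow> nat set \<Rightarrow> (nat \<times> nat) set \<Rightarrow> binop \<Rightarrow> bool" where
  "canonical S1 S2 D g \<longleftrightarrow>
     (\<exists>c. \<forall>(x, y)\<in>D. g (x, y) = c) \<or>
     (\<exists>G :: nat \<Rightarrow> nat. inj_on G S1 \<and> (\<forall>(x, y)\<in>D. g (x, y) = G x)) \<or>
     (\<exists>G :: nat \<Rightarrow> nat. inj_on G S2 \<and> (\<forall>(x, y)\<in>D. g (x, y) = G y)) \<or>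
     inj_on g D"

definition canonical_on :: "binop \<Rightarrow> nat set \<Rightarrow> nat set \<Rightarrow> bool" where
  "canonical_on f S1 S2 \<longleftrightarrow>
     infinite S1 \<and> infinite S2 \<and>
     canonical S1 S2 (Delta S1 S2) f \<and> canonical S1 S2 (Nabla S1 S2) f \<and>
     (f ` Delta S1 S2 \<inter> f ` Nabla S1 S2 = {} \<or>
      S1 = S2 \<and> (\<forall>x\<in>S1. \<forall>y\<in>S1. f (x, y) = f (y, x)))"

definition nowhere_injective :: "binop \<Rightarrow> bool" where
  "nowhere_injective f \<longleftrightarrow>
     (\<forall>S1 S2. canonical_on f S1 S2 \<longrightarrow>
        \<not> inj_on f (Delta S1 S2) \<and> \<not> inj_on f (Nabla S1 S2))"

definition T2 :: "binop set" where
  "T2 = {f. nowhere_injective f}"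

end

theory Submission
  imports Defs "HOL-Library.Ramsey" "HOL-Library.Sublist"
begin

text \<open>The proof is a diagonalisation over continuous maps. Terms over countably many operations and
  arbitrary unary functions are evaluated by a map \<open>\<Phi>\<close> from sequences of naturals to binary
  functions, each value of which depends on finitely many entries of the sequence. If
  \<open>range \<Phi> \<subseteq> T2\<close>, build simultaneously a tree of finite sequences and a function \<open>g\<close>: a sequence is
  a node if it is compatible with \<open>g = \<Phi> w\<close> for some \<open>w\<close> extending it, as far as the part of \<open>g\<close>
  already fixed by shorter nodes can tell, and \<open>g\<close> is injective on the pairs of comparable nodes and
  zero elsewhere. An infinite branch is the same as a \<open>w\<close> with \<open>g = \<Phi> w\<close>, and it makes \<open>g\<close>
  injective on an infinite triangle, that is, not in \<open>T2\<close>. Hence there is no infinite branch, so \<open>g\<close>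
  is not a value of \<open>\<Phi>\<close>, while \<open>g\<close> lies in \<open>T1 \<inter> T2\<close> and even preserves \<open>T2\<close>. The last point uses
  the canonical Ramsey theorem of Erdos and Rado: two functions in \<open>T2\<close> that are jointly injective on
  an infinite triangle are, on a subtriangle, injective functions of one coordinate each.\<close>

section \<open>Canonical Ramsey theory for pairs\<close>

text \<open>Two pairs of naturals span at most four points, so a homogeneous sequence for quadruples
  decides every equation between values at two pairs. A 4-set is coloured through its increasing
  enumeration.\<close>

lemma Ramsey_quadruples:
  fixes F :: "nat \<Rightarrow> nat \<Rightarrow> nat \<Rightarrow> nat \<Rightarrow> 'c :: finite"
  shows "\<exists>(e :: nat \<Rightarrow> nat) c. strict_mono e \<and>
    (\<forall>i j k l. i < j \<and> j < k \<and> k < l \<longrightarrow> F (e i) (e j) (e k) (e l) = c)"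
proof -
  obtain code :: "'c \<Rightarrow> nat" and s where code: "code ` UNIV = {i. i < s}" "inj code"
    using finite_imp_inj_to_nat_seg[of "UNIV :: 'c set"] by auto
  define C where "C X = (let xs = sorted_list_of_set X in code (F (xs!0) (xs!1) (xs!2) (xs!3)))" for X
  have "C X < s" for X using code(1) by (auto simp: C_def Let_def)
  then obtain Y t where Y: "infinite Y" and t: "\<forall>X. X \<subseteq> Y \<and> finite X \<and> card X = 4 \<longrightarrow> C X = t"
    using Ramsey[of "UNIV :: nat set" 4 C s] by auto
  define e where "e = enumerate Y"
  have e: "strict_mono e" "\<And>i. e i \<in> Y"
    using Y by (auto simp: e_def strict_mono_enumerate enumerate_in_set)
  have "F (e i) (e j) (e k) (e l) = inv code t" if "i < j" "j < k" "k < l" for i j k l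
  proof -
    have lt: "e i < e j" "e j < e k" "e k < e l" using that e(1) by (auto simp: strict_mono_def)
    let ?X = "{e i, e j, e k, e l}"
    have "sorted_list_of_set ?X = [e i, e j, e k, e l]"
      using lt by (intro sorted_list_of_set_unique[THEN iffD1]) auto
    then have "C ?X = code (F (e i) (e j) (e k) (e l))" by (simp add: C_def eval_nat_numeral)
    moreover have "C ?X = t" using t e(2) lt by simp
    ultimately show ?thesis using code(2) by (metis inv_f_f)
  qed
  with e(1) show ?thesis by (intro exI[of _ e] exI[of _ "inv code t"]) simp
qed

definition canonical_pairs :: "(nat \<Rightarrow> nat \<Rightarrow> nat) \<Rightarrow> bool" where
  "canonical_pairs h \<longleftrightarrow>
     (\<exists>c. \<forall>i j. i < j \<longrightarrow> h i j = c) \<or>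
     (\<exists>G. inj G \<and> (\<forall>i j. i < j \<longrightarrow> h i j = G i)) \<or>
     (\<exists>G. inj G \<and> (\<forall>i j. i < j \<longrightarrow> h i j = G j)) \<or>
     inj_on (\<lambda>(i, j). h i j) {(i, j). i < j}"

lemma canonical_pairsI:
  "(\<And>i j. i < j \<Longrightarrow> h i j = c) \<Longrightarrow> canonical_pairs h"
  "inj G \<Longrightarrow> (\<And>i j. i < j \<Longrightarrow> h i j = G i) \<Longrightarrow> canonical_pairs h"
  "inj G \<Longrightarrow> (\<And>i j. i < j \<Longrightarrow> h i j = G j) \<Longrightarrow> canonical_pairs h"
  "inj_on (\<lambda>(i, j). h i j) {(i, j). i < j} \<Longrightarrow> canonical_pairs h"
  unfolding canonical_pairs_def
  subgoal by (intro disjI1 exI[of _ c]) simp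
  subgoal by (intro disjI2[OF disjI1] exI[of _ G]) simp
  subgoal by (intro disjI2[OF disjI2[OF disjI1]] exI[of _ G]) simp
  subgoal by simp
  done

text \<open>The colour of a quadruple records one equation for each relative position of two
  distinct pairs. On a homogeneous sequence \<open>b1\<close> makes the second index irrelevant and
  \<open>b3\<close> the first; if both fail, so do all the other equations, and the function is
  injective.\<close>

lemma Erdos_Rado_pairs:
  fixes h :: "nat \<Rightarrow> nat \<Rightarrow> nat"
  obtains e :: "nat \<Rightarrow> nat" where "strict_mono e" "canonical_pairs (\<lambda>i j. h (e i) (e j))"
proof -
  \<comment> \<open>Three positions with a common point (same minimum, chain, same maximum), then
    three disjoint ones (separated, crossing, nested).\<close>
  define F where "F i j k l = (h i j = h i k, h i j = h j k, h i k = h j k,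
      h i j = h k l, h i k = h j l, h i l = h j k)" for i j k l
  obtain d :: "nat \<Rightarrow> nat" and c where d: "strict_mono d"
    and c: "\<And>i j k l. i < j \<and> j < k \<and> k < l \<longrightarrow> F (d i) (d j) (d k) (d l) = c"
    using Ramsey_quadruples[of F] by blast
  obtain b1 b2 b3 b4 b5 b6 where cb: "c = (b1, b2, b3, b4, b5, b6)" by (cases c)
  define k where "k i j = h (d i) (d j)" for i j
  have hom3: "(k i j = k i l) = b1" "(k i j = k j l) = b2" "(k i l = k j l) = b3"
    if "i < j" "j < l" for i j l :: nat
    using c[of i j l "Suc l"] that by (simp_all add: F_def k_def cb)
  have hom4: "(k i j = k l m) = b4" "(k i l = k j m) = b5" "(k i m = k j l) = b6"
    if "i < j" "j < l" "l < m" for i j l m :: nat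
    using c[of i j l m] that by (simp_all add: F_def k_def cb)
  \<comment> \<open>Index 0 is dropped to serve as a reference point below all others: it supplies
    the constant and, if only the second index matters, the function \<open>G\<close>.\<close>
  have "canonical_pairs (\<lambda>i j. k (Suc i) (Suc j))"
  proof (cases b1)
    case True
    then have "k i j = k i l" if "i < j" "i < l" for i j l :: nat
      using hom3(1) that by (metis linorder_neqE_nat)
    then have G: "k i j = k i (Suc i)" if "i < j" for i j using that by blast
    show ?thesis
    proof (cases b3)
      case b3: True
      have "k i (Suc i) = k 0 (Suc 0)" if "0 < i" for i
        using hom3(3)[OF that lessI] G[of 0 "Suc i"] b3 by simp
      then have "k (Suc i) (Suc j) = k 0 (Suc 0)" if "i < j" for i j
        using G[of "Suc i" "Suc j"] that by simp
      then show ?thesis by (rule canonical_pairsI(1))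
    next
      case False
      have "k (Suc i) (Suc (Suc i)) \<noteq> k (Suc j) (Suc (Suc j))" if "i < j" for i j
        using hom3(3)[of "Suc i" "Suc j" "Suc (Suc j)"] G[of "Suc i" "Suc (Suc j)"] False that
        by simp
      then have "inj (\<lambda>i. k (Suc i) (Suc (Suc i)))" by (rule linorder_injI)
      moreover have "k (Suc i) (Suc j) = k (Suc i) (Suc (Suc i))" if "i < j" for i j
        using G[of "Suc i" "Suc j"] that by simp
      ultimately show ?thesis by (rule canonical_pairsI(2))
    qed
  next
    case n1: False
    show ?thesis
    proof (cases b3)
      case True
      then have G: "k (Suc i) (Suc j) = k 0 (Suc j)" if "i < j" for i j
        using hom3(3)[of 0 "Suc i" "Suc j"] that by simp
      have "k 0 (Suc i) \<noteq> k 0 (Suc j)" if "i < j" for i j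
        using hom3(1)[of 0 "Suc i" "Suc j"] n1 that by simp
      then have "inj (\<lambda>j. k 0 (Suc j))" by (rule linorder_injI)
      then show ?thesis using G by (rule canonical_pairsI(3))
    next
      case n3: False
      \<comment> \<open>Each of these equations would give one pair the same value as two pairs with
        equal minimum and different maximum, against \<open>n1\<close>.\<close>
      have n2: "\<not> b2" using hom3(2)[of 0 1 2] hom3(2)[of 0 1 3] hom3(1)[of 1 2 3] n1 by auto
      have n4: "\<not> b4" using hom4(1)[of 0 1 2 3] hom4(1)[of 0 1 2 4] hom3(1)[of 2 3 4] n1 by auto
      have n5: "\<not> b5" using hom4(2)[of 0 1 2 3] hom4(2)[of 0 1 2 4] hom3(1)[of 1 3 4] n1 by auto
      have n6: "\<not> b6" using hom4(3)[of 0 2 3 5] hom4(3)[of 0 2 4 5] hom3(1)[of 2 3 4] n1 by auto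
      have ne: "k i j \<noteq> k l m" if "i < j" "l < m" "i < l" for i j l m :: nat
      proof -
        consider "j < l" | "j = l" | "l < j" "j < m" | "j = m" | "m < j" by linarith
        then show ?thesis
        proof cases
          case 1 then show ?thesis using hom4(1)[of i j l m] that n4 by simp
        next
          case 2 then show ?thesis using hom3(2)[of i j m] that n2 by simp
        next
          case 3 then show ?thesis using hom4(2)[of i l j m] that n5 by simp
        next
          case 4 then show ?thesis using hom3(3)[of i l m] that n3 by simp
        next
          case 5 then show ?thesis using hom4(3)[of i l m j] that n6 by simp
        qed
      qed
      have inj: "i = l \<and> j = m" if "i < j" "l < m" "k i j = k l m" for i j l m :: nat
      proof -
        have "i = l" using ne[of i j l m] ne[of l m i j] that by (cases i l rule: linorder_cases) simp_all
        moreover have "j = m"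
          using hom3(1)[of i j m] hom3(1)[of i m j] n1 that \<open>i = l\<close>
          by (cases j m rule: linorder_cases) simp_all
        ultimately show ?thesis ..
      qed
      have "inj_on (\<lambda>(i, j). k (Suc i) (Suc j)) {(i, j). i < j}"
      proof (intro inj_onI, clarify)
        fix i j l m assume "i < j" "l < m" "k (Suc i) (Suc j) = k (Suc l) (Suc m)"
        then show "i = l \<and> j = m" using inj[of "Suc i" "Suc j" "Suc l" "Suc m"] by simp
      qed
      then show ?thesis by (rule canonical_pairsI(4))
    qed
  qed
  moreover have "strict_mono (\<lambda>i. d (Suc i))" using d by (simp add: strict_mono_def)
  ultimately show thesis using that by (simp add: k_def)
qed

lemma canonical_pairs_subsequence:
  assumes "canonical_pairs h" "strict_mono e"
  shows "canonical_pairs (\<lambda>i j. h (e i) (e j))"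
proof -
  have e: "inj e" "\<And>i j. i < j \<Longrightarrow> e i < e j"
    using strict_mono_imp_inj_on[OF assms(2)] strict_monoD[OF assms(2)] by blast+
  from assms(1)[unfolded canonical_pairs_def] show ?thesis
  proof (elim disjE exE conjE)
    fix c assume c: "\<forall>i j. i < j \<longrightarrow> h i j = c"
    show ?thesis by (rule canonical_pairsI(1)) (simp add: c e(2))
  next
    fix G assume "inj G" and G: "\<forall>i j. i < j \<longrightarrow> h i j = G i"
    show ?thesis
      by (rule canonical_pairsI(2)[OF inj_compose[OF \<open>inj G\<close> e(1)]]) (simp add: G e(2))
  next
    fix G assume "inj G" and G: "\<forall>i j. i < j \<longrightarrow> h i j = G j"
    show ?thesis
      by (rule canonical_pairsI(3)[OF inj_compose[OF \<open>inj G\<close> e(1)]]) (simp add: G e(2))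
  next
    assume inj: "inj_on (\<lambda>(i, j). h i j) {(i, j). i < j}"
    show ?thesis
    proof (intro canonical_pairsI(4) inj_onI, clarify)
      fix i j i' j' assume "i < j" "i' < j'" "h (e i) (e j) = h (e i') (e j')"
      then have "(e i, e j) = (e i', e j')"
        using e(2) by (intro inj_onD[OF inj]) simp_all
      then show "i = i' \<and> j = j'" using e(1) by (simp add: inj_eq)
    qed
  qed
qed

section \<open>Interleaved sequences\<close>

definition interleaved :: "(nat \<Rightarrow> nat) \<Rightarrow> (nat \<Rightarrow> nat) \<Rightarrow> bool" where
  "interleaved a b \<longleftrightarrow> (\<forall>i. a i < b i \<and> b i < a (Suc i))"

lemma interleaved_less:
  assumes "interleaved a b"
  shows "strict_mono a" "strict_mono b" "a i < b j \<longleftrightarrow> i \<le> j" "b j < a i \<longleftrightarrow> j < i"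
proof -
  have s: "a i < b i" "b i < a (Suc i)" for i using assms by (simp_all add: interleaved_def)
  then show a: "strict_mono a" and b: "strict_mono b"
    unfolding strict_mono_Suc_iff by (meson less_trans)+
  have 1: "a i < b j" if "i \<le> j" for i j
    using less_le_trans[OF s(1) monoD[OF strict_mono_mono[OF b] that]] .
  have 2: "b j < a i" if "j < i" for i j
    using less_le_trans[OF s(2) monoD[OF strict_mono_mono[OF a] Suc_leI[OF that]]] .
  show "a i < b j \<longleftrightarrow> i \<le> j" "b j < a i \<longleftrightarrow> j < i"
    using 1[of i j] 2[of j i] by (cases "i \<le> j"; simp)+
qed

lemma interleavedI:
  assumes "interleaved a b" "strict_mono d" "strict_mono e" "\<And>i. d i \<le> e i" "\<And>i. e i < d (Suc i)"
  shows "interleaved (\<lambda>i. a (d i)) (\<lambda>i. b (e i))"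
  unfolding interleaved_def using assms(2-) interleaved_less(3,4)[OF assms(1)] by simp

lemma interleaved_subsequence:
  assumes "interleaved a b" "strict_mono e"
  shows "interleaved (\<lambda>i. a (e i)) (\<lambda>i. b (e i))"
  by (rule interleavedI) (simp_all add: assms strict_mono_less)

lemma obtain_interleaved:
  assumes "infinite S1" "infinite S2"
  obtains a b where "interleaved a b" "range a \<subseteq> S1" "range b \<subseteq> S2"
proof -
  have ex: "\<exists>x y. x \<in> S1 \<and> y \<in> S2 \<and> n < x \<and> x < y" for n
    using assms unfolding infinite_nat_iff_unbounded by blast
  have "\<exists>f. \<forall>n. (fst (f n) \<in> S1 \<and> snd (f n) \<in> S2 \<and> fst (f n) < snd (f n)) \<and>
      snd (f n) < fst (f (Suc n))"
    by (rule dependent_nat_choice) (use ex in fastforce)+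
  then obtain f where f: "\<And>n. fst (f n) \<in> S1 \<and> snd (f n) \<in> S2 \<and> fst (f n) < snd (f n) \<and>
      snd (f n) < fst (f (Suc n))" by blast
  show thesis
    by (rule that[of "fst \<circ> f" "snd \<circ> f"]) (use f in \<open>auto simp: interleaved_def\<close>)
qed

text \<open>Interleaving turns triangles over the two ranges into triangles of indices. Here the
  smaller index is written first, as in \<open>canonical_pairs\<close>; the diagonal of indices
  falls into the upper triangle.\<close>

lemma Delta_interleaved:
  assumes "interleaved a b"
  shows "Delta (range a) (range b) = (\<lambda>(j, i). (a i, b j)) ` {(j, i). j < i}"
  using interleaved_less[OF assms] by (auto simp: Delta_def image_iff)

lemma Nabla_interleaved:
  assumes "interleaved a b"
  shows "Nabla (range a) (range b) = (\<lambda>(i, j). (a i, b j)) ` {(i, j). i \<le> j}"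
  using interleaved_less[OF assms] by (auto simp: Nabla_def image_iff)

section \<open>Injectivity on triangles\<close>

text \<open>The upper triangle contains the diagonal of indices, on which
  \<open>canonical_pairs\<close> is silent. The maps \<open>d\<close> and \<open>e\<close> move it
  to strictly increasing pairs, for instance of an even and an odd index.\<close>

lemma canonical_Nabla_interleaved:
  assumes "interleaved a b" "canonical_pairs h"
    "\<And>i j. i \<le> j \<Longrightarrow> f (a i, b j) = h (d i) (e j)"
    and de: "inj d" "inj e" "\<And>i j. i \<le> j \<Longrightarrow> d i < e j"
  shows "canonical (range a) (range b) (Nabla (range a) (range b)) f"
proof -
  note il = interleaved_less[OF assms(1)]
  have inj: "inj a" "inj b" using il by (simp_all add: strict_mono_imp_inj_on)
  have ball: "(\<forall>(x, y)\<in>Nabla (range a) (range b). f (x, y) = H x y) \<longleftrightarrow>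
      (\<forall>i j. i \<le> j \<longrightarrow> h (d i) (e j) = H (a i) (b j))" for H
  proof -
    have "(\<forall>(x, y)\<in>Nabla (range a) (range b). f (x, y) = H x y) \<longleftrightarrow>
        (\<forall>i j. i \<le> j \<longrightarrow> f (a i, b j) = H (a i) (b j))"
      unfolding Nabla_interleaved[OF assms(1)] by auto
    then show ?thesis by (simp add: assms(3) cong: imp_cong)
  qed
  have inj_G: "inj_on (\<lambda>x. G (g (inv c x))) (range c)"
    if "inj c" "inj g" "inj G" for c g G :: "nat \<Rightarrow> nat"
    using comp_inj_on_iff[OF that(1), of "\<lambda>x. G (g (inv c x))"] inj_compose[OF that(3,2)] that(1)
    by (simp add: comp_def)
  from assms(2)[unfolded canonical_pairs_def] show ?thesis
  proof (elim disjE exE conjE)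
    fix c assume c: "\<forall>i j. i < j \<longrightarrow> h i j = c"
    have "\<forall>(x, y)\<in>Nabla (range a) (range b). f (x, y) = c"
      unfolding ball[of "\<lambda>x y. c"] using c de(3) by simp
    then show ?thesis unfolding canonical_def by (rule disjI1[OF exI])
  next
    fix G assume "inj G" and G: "\<forall>i j. i < j \<longrightarrow> h i j = G i"
    have "\<forall>(x, y)\<in>Nabla (range a) (range b). f (x, y) = G (d (inv a x))"
      unfolding ball[of "\<lambda>x y. G (d (inv a x))"] using G de(3) inj by simp
    with inj_G[OF inj(1) de(1) \<open>inj G\<close>] show ?thesis
      unfolding canonical_def by (intro disjI2[OF disjI1] exI[of _ "\<lambda>x. G (d (inv a x))"] conjI)
  next
    fix G assume "inj G" and G: "\<forall>i j. i < j \<longrightarrow> h i j = G j"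
    have "\<forall>(x, y)\<in>Nabla (range a) (range b). f (x, y) = G (e (inv b y))"
      unfolding ball[of "\<lambda>x y. G (e (inv b y))"] using G de(3) inj by simp
    with inj_G[OF inj(2) de(2) \<open>inj G\<close>] show ?thesis
      unfolding canonical_def
      by (intro disjI2[OF disjI2[OF disjI1]] exI[of _ "\<lambda>x. G (e (inv b x))"] conjI)
  next
    assume h: "inj_on (\<lambda>(i, j). h i j) {(i, j). i < j}"
    have "inj_on f (Nabla (range a) (range b))"
      unfolding Nabla_interleaved[OF assms(1)]
    proof (intro inj_onI, clarify)
      fix i j i' j' assume "i \<le> j" "i' \<le> j'" "f (a i, b j) = f (a i', b j')"
      then have "(d i, e j) = (d i', e j')"
        using assms(3) de(3) by (intro inj_onD[OF h]) simp_all
      then show "a i = a i' \<and> b j = b j'" using de(1,2) by (simp add: inj_eq)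
    qed
    then show ?thesis unfolding canonical_def by (intro disjI2)
  qed
qed

text \<open>An injective lower triangle can be separated from the upper one: a coincidence between a
  lower and an upper value that holds for a whole order type of indices would hold for two
  different lower pairs and the same upper pair.\<close>

lemma separate_triangles:
  fixes f :: "nat \<Rightarrow> nat \<Rightarrow> nat"
  assumes inj: "inj_on (\<lambda>(j, i). f i j) {(j, i). j < i}"
  shows "\<exists>e :: nat \<Rightarrow> nat. strict_mono e \<and>
    (\<forall>i j k l. j < i \<longrightarrow> k < l \<longrightarrow> i \<noteq> l \<longrightarrow> j \<noteq> k \<longrightarrow> f (e i) (e j) \<noteq> f (e k) (e l))"
proof -
  \<comment> \<open>A lower and an upper pair with different minima and different maxima have eight
    relative positions: chain, separated, crossing and nested, each in two ways.\<close>
  define F where "F i j k l =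
    (f j i = f j k, f k j = f i j, f j i = f k l, f l k = f i j,
     f k i = f j l, f l j = f i k, f l i = f j k, f k j = f i l)" for i j k l
  obtain e :: "nat \<Rightarrow> nat" and c where e: "strict_mono e"
    and c: "\<And>i j k l. i < j \<and> j < k \<and> k < l \<longrightarrow> F (e i) (e j) (e k) (e l) = c"
    using Ramsey_quadruples[of F] by blast
  obtain b1 b2 b3 b4 b5 b6 r where cr: "c = (b1, b2, b3, b4, b5, b6, r)" by (cases c)
  obtain b7 b8 where cb: "c = (b1, b2, b3, b4, b5, b6, b7, b8)" using cr by (cases r) simp
  define g where "g i j = f (e i) (e j)" for i j
  have hom: "(g j i = g j k) = b1" "(g k j = g i j) = b2" "(g j i = g k l) = b3"
      "(g l k = g i j) = b4" "(g k i = g j l) = b5" "(g l j = g i k) = b6"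
      "(g l i = g j k) = b7" "(g k j = g i l) = b8"
    if "i < j" "j < k" "k < l" for i j k l
    using c[of i j k l] that by (simp_all add: F_def g_def cb)
  have g: "i = i' \<and> j = j'" if "j < i" "j' < i'" "g i j = g i' j'" for i j i' j'
  proof -
    have "(e j, e i) = (e j', e i')"
      using that strict_monoD[OF e] by (intro inj_onD[OF inj]) (simp_all add: g_def)
    then show ?thesis by (simp add: strict_mono_eq[OF e])
  qed
  have n: "\<not> b1" "\<not> b2" "\<not> b3" "\<not> b4" "\<not> b5" "\<not> b6" "\<not> b7" "\<not> b8"
    subgoal using hom(1)[of 0 2 3 4] hom(1)[of 1 2 3 4] g[of 0 2 1 2] by auto
    subgoal using hom(2)[of 1 2 3 5] hom(2)[of 1 2 4 5] g[of 2 3 2 4] by auto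
    subgoal using hom(3)[of 0 2 3 4] hom(3)[of 1 2 3 4] g[of 0 2 1 2] by auto
    subgoal using hom(4)[of 0 1 2 3] hom(4)[of 0 1 2 4] g[of 2 3 2 4] by auto
    subgoal using hom(5)[of 0 2 3 4] hom(5)[of 1 2 3 4] g[of 0 3 1 3] by auto
    subgoal using hom(6)[of 0 1 2 3] hom(6)[of 0 1 2 4] g[of 1 3 1 4] by auto
    subgoal using hom(7)[of 0 1 2 3] hom(7)[of 0 1 2 4] g[of 0 3 0 4] by auto
    subgoal using hom(8)[of 0 1 2 4] hom(8)[of 0 1 3 4] g[of 1 2 1 3] by auto
    done
  have "g i j \<noteq> g k l" if ord: "j < i" "k < l" "i \<noteq> l" "j \<noteq> k" for i j k l
  proof -
    consider "i = k" | "j = l" | "i < k" | "l < j" | "j < k" "k < i" "i < l" | "k < j" "j < l" "l < i"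
      | "j < k" "l < i" | "k < j" "i < l" using ord by linarith
    then show ?thesis
    proof cases
      case 1 then show ?thesis using hom(1)[of j i l "Suc l"] ord n by simp
    next
      case 2 then show ?thesis using hom(2)[of k j i "Suc i"] ord n by simp
    next
      case 3 then show ?thesis using hom(3)[of j i k l] ord n by simp
    next
      case 4 then show ?thesis using hom(4)[of k l j i] ord n by simp
    next
      case 5 then show ?thesis using hom(5)[of j k i l] ord n by simp
    next
      case 6 then show ?thesis using hom(6)[of k j l i] ord n by simp
    next
      case 7 then show ?thesis using hom(7)[of j k l i] ord n by simp
    next
      case 8 then show ?thesis using hom(8)[of k j i l] ord n by simp
    qed
  qed
  with e show ?thesis unfolding g_def by (intro exI[of _ e]) simp
qed

text \<open>\<open>nowhere_injective\<close> speaks only of products on which \<open>f\<close> is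
  canonical. Injectivity of the lower triangle survives thinning, which first makes the upper
  triangle canonical and then separates the two ranges; so \<open>f\<close> becomes canonical with
  an injective half.\<close>

lemma T2_not_inj_lower:
  assumes "f \<in> T2" and ab: "interleaved a b"
  shows "\<not> inj_on (\<lambda>(j, i). f (a i, b j)) {(j, i). j < i}"
proof
  assume inj: "inj_on (\<lambda>(j, i). f (a i, b j)) {(j, i). j < i}"
  obtain d where d: "strict_mono d"
    and canon: "canonical_pairs (\<lambda>i j. f (a (d i), b (d j)))"
    using Erdos_Rado_pairs[of "\<lambda>i j. f (a i, b j)"] by blast
  define g where "g i j = f (a (d i), b (d j))" for i j
  have inj_d: "inj_on (\<lambda>(j, i). f (a (d i), b (d j))) {(j, i). j < i}"
  proof (intro inj_onI, clarify)
    fix j i j' i' assume "j < i" "j' < i'" "f (a (d i), b (d j)) = f (a (d i'), b (d j'))"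
    then have "(d j, d i) = (d j', d i')"
      using strict_monoD[OF d] by (intro inj_onD[OF inj]) simp_all
    then show "j = j' \<and> i = i'" by (simp add: strict_mono_eq[OF d])
  qed
  then obtain e :: "nat \<Rightarrow> nat" where e: "strict_mono e" and sep: "\<forall>i j k l.
      j < i \<longrightarrow> k < l \<longrightarrow> i \<noteq> l \<longrightarrow> j \<noteq> k \<longrightarrow> g (e i) (e j) \<noteq> g (e k) (e l)"
    using separate_triangles[of g] unfolding g_def by auto
  \<comment> \<open>Even indices for the first coordinate and odd ones for the second rule out the cases
    \<open>i = l\<close> and \<open>j = k\<close>, about which nothing is known.\<close>
  define x where "x i = a (d (e (2 * i)))" for i
  define y where "y j = b (d (e (2 * j + 1)))" for j
  have xy: "interleaved x y"
    unfolding x_def y_def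
    by (rule interleavedI[OF ab]) (simp_all add: strict_mono_less[OF d] strict_mono_less[OF e]
        strict_mono_less_eq[OF d] strict_mono_less_eq[OF e] strict_mono_def)
  have f: "f (x i, y j) = g (e (2 * i)) (e (2 * j + 1))" for i j
    by (simp add: x_def y_def g_def)
  let ?X = "range x" and ?Y = "range y"
  have "infinite ?X" "infinite ?Y"
    using interleaved_less(1,2)[OF xy] by (simp_all add: range_inj_infinite strict_mono_imp_inj_on)
  moreover have inj_Delta: "inj_on f (Delta ?X ?Y)"
    unfolding Delta_interleaved[OF xy]
  proof (intro inj_onI, clarify)
    fix j i j' i' assume "j < i" "j' < i'" "f (x i, y j) = f (x i', y j')"
    then have "(e (2 * j + 1), e (2 * i)) = (e (2 * j' + 1), e (2 * i'))"
      using f by (intro inj_onD[OF inj_d]) (simp_all add: strict_mono_less[OF e] g_def)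
    then have "j = j' \<and> i = i'" by (simp add: strict_mono_eq[OF e])
    then show "x i = x i' \<and> y j = y j'" by simp
  qed
  moreover have "canonical ?X ?Y (Nabla ?X ?Y) f"
    by (rule canonical_Nabla_interleaved[OF xy canon,
          where d = "\<lambda>i. e (2 * i)" and e = "\<lambda>j. e (2 * j + 1)"])
      (simp_all add: f g_def strict_mono_less[OF e] strict_mono_eq[OF e] inj_def)
  moreover have "f ` Delta ?X ?Y \<inter> f ` Nabla ?X ?Y = {}"
  proof -
    have "f (x i, y j) \<noteq> f (x k, y l)" if "j < i" "k \<le> l" for i j k l
      unfolding f using that by (intro sep[rule_format]; presburger)
    then show ?thesis
      unfolding Delta_interleaved[OF xy] Nabla_interleaved[OF xy] by fastforce
  qed
  ultimately have "canonical_on f ?X ?Y"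
    unfolding canonical_on_def canonical_def[of _ _ "Delta _ _"] by blast
  with \<open>f \<in> T2\<close> inj_Delta show False unfolding T2_def nowhere_injective_def by blast
qed

section \<open>Exchanging the coordinates\<close>

lemma Delta_Nabla_swap:
  "Delta S2 S1 = prod.swap ` Nabla S1 S2" "Nabla S2 S1 = prod.swap ` Delta S1 S2"
  by (auto simp: Delta_def Nabla_def)

lemma inj_on_swap: "inj_on f (prod.swap ` A) \<longleftrightarrow> inj_on (\<lambda>p. f (prod.swap p)) A"
  using comp_inj_on_iff[of prod.swap A f] by (simp add: comp_def)

lemma canonical_swap:
  assumes "canonical S1 S2 D (\<lambda>p. f (prod.swap p))"
  shows "canonical S2 S1 (prod.swap ` D) f"
proof -
  have ball: "(\<forall>(x, y)\<in>prod.swap ` D. f (x, y) = H x y) \<longleftrightarrow> (\<forall>(x, y)\<in>D. f (y, x) = H y x)" for H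
    by auto
  from assms show ?thesis
    unfolding canonical_def ball[of "\<lambda>x y. G x" for G] ball[of "\<lambda>x y. G y" for G]
      ball[of "\<lambda>x y. c" for c] inj_on_swap
    by (elim disjE) (simp_all add: disj_commute)
qed

text \<open>The definition of \<open>T2\<close> is symmetric in the two triangles; this reduces
  upper triangles to lower ones.\<close>

lemma T2_swap:
  assumes "f \<in> T2"
  shows "(\<lambda>p. f (prod.swap p)) \<in> T2"
proof -
  have "canonical_on f S2 S1" if "canonical_on (\<lambda>p. f (prod.swap p)) S1 S2" for S1 S2
    using that canonical_swap[of S1 S2 _ f]
    unfolding canonical_on_def Delta_Nabla_swap[of S2 S1] by (auto simp: image_image)
  then have "\<not> inj_on f (Delta S2 S1) \<and> \<not> inj_on f (Nabla S2 S1)"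
    if "canonical_on (\<lambda>p. f (prod.swap p)) S1 S2" for S1 S2
    using that assms unfolding T2_def nowhere_injective_def by simp
  then show ?thesis
    unfolding T2_def nowhere_injective_def mem_Collect_eq inj_on_swap[symmetric]
    by (simp add: Delta_Nabla_swap[symmetric])
qed

section \<open>Functions given by trees\<close>

text \<open>Each triangle over infinite sets contains two points with the same first coordinate and
  two with the same second.\<close>

lemma projections_in_T2: "fst \<in> T2" "snd \<in> T2"
proof -
  have "\<not> inj_on fst (Delta S1 S2) \<and> \<not> inj_on fst (Nabla S1 S2) \<and>
      \<not> inj_on snd (Delta S1 S2) \<and> \<not> inj_on snd (Nabla S1 S2)"
    if inf: "infinite S1" "infinite S2" for S1 S2
  proof -
    obtain a b where ab: "interleaved a b" and sub: "range a \<subseteq> S1" "range b \<subseteq> S2"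
      using obtain_interleaved[OF inf] .
    have D: "(a i, b j) \<in> Delta S1 S2" if "j < i" for i j
      using that sub interleaved_less(4)[OF ab] by (auto simp: Delta_def)
    have N: "(a i, b j) \<in> Nabla S1 S2" if "i \<le> j" for i j
      using that sub interleaved_less(3)[OF ab] by (auto simp: Nabla_def)
    have ne: "a 0 \<noteq> a 1" "a 1 \<noteq> a 2" "b 0 \<noteq> b 1"
      using interleaved_less(1,2)[OF ab] by (simp_all add: strict_mono_eq)
    have "\<not> inj_on fst (Delta S1 S2)"
      using inj_onD[of fst "Delta S1 S2" "(a 2, b 0)" "(a 2, b 1)"] D ne by auto
    moreover have "\<not> inj_on fst (Nabla S1 S2)"
      using inj_onD[of fst "Nabla S1 S2" "(a 0, b 0)" "(a 0, b 1)"] N ne by auto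
    moreover have "\<not> inj_on snd (Delta S1 S2)"
      using inj_onD[of snd "Delta S1 S2" "(a 1, b 0)" "(a 2, b 0)"] D ne by auto
    moreover have "\<not> inj_on snd (Nabla S1 S2)"
      using inj_onD[of snd "Nabla S1 S2" "(a 0, b 1)" "(a 1, b 1)"] N ne by auto
    ultimately show ?thesis by blast
  qed
  then show "fst \<in> T2" "snd \<in> T2"
    unfolding T2_def nowhere_injective_def canonical_on_def by simp_all
qed

text \<open>Natural numbers code finite sequences, listed from the last entry to the first, so that
  suffixes are initial segments.\<close>

definition tree_fun :: "nat set \<Rightarrow> binop" where
  "tree_fun N = (\<lambda>(x, y). if strict_suffix (list_decode y) (list_decode x) \<and> x \<in> N \<and> y \<in> N
     then Suc (prod_encode (x, y)) else 0)"

text \<open>Initial segments have smaller codes, so \<open>y < x\<close> fixes the only possible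
  direction of comparison. The chain need not contain all initial segments of the infinite sequence
  it determines.\<close>

definition branch :: "nat set \<Rightarrow> bool" where
  "branch S \<longleftrightarrow> infinite S \<and>
     (\<forall>x\<in>S. \<forall>y\<in>S. y < x \<longrightarrow> strict_suffix (list_decode y) (list_decode x))"

lemma suffix_imp_list_encode_le: "suffix xs ys \<Longrightarrow> list_encode xs \<le> list_encode ys"
proof (induction ys)
  case (Cons y ys)
  then show ?case
    using le_prod_encode_2[of "list_encode ys" y] by (auto simp: suffix_Cons)
qed simp

lemma strict_suffix_imp_less: "strict_suffix (list_decode y) (list_decode x) \<Longrightarrow> y < x"
  using suffix_imp_list_encode_le[of "list_decode y" "list_decode x"]
  by (metis list_decode_inverse order_le_less strict_suffix_def)

text \<open>For the recursion defining the tree: numbers below the length of the sequence coded by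
  \<open>z\<close> are below \<open>z\<close>, hence decided before \<open>z\<close>.\<close>

lemma length_list_decode_le: "length (list_decode z) \<le> z"
proof -
  have "length xs \<le> list_encode xs" for xs
  proof (induction xs)
    case (Cons x xs)
    then show ?case using le_prod_encode_2[of "list_encode xs" x] by simp
  qed simp
  from this[of "list_decode z"] show ?thesis by simp
qed

text \<open>Nonzero values require \<open>y < x\<close>, so for fixed \<open>x\<close> there are
  finitely many, and their sum is a bound.\<close>

lemma tree_fun_in_T1: "tree_fun N \<in> T1"
proof -
  have "tree_fun N (x, y) \<le> (\<Sum>y<x. tree_fun N (x, y))" for x y
  proof (cases "y < x")
    case True
    then show ?thesis by (intro member_le_sum[of y "{..<x}" "\<lambda>y. tree_fun N (x, y)"]) simp_all
  next
    case False
    then show ?thesis using strict_suffix_imp_less[of y x] by (auto simp: tree_fun_def)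
  qed
  then have "\<forall>x y. tree_fun N (x, y) \<le> (\<lambda>x. \<Sum>y<x. tree_fun N (x, y)) x" by simp
  then show ?thesis unfolding T1_def almost_unary_def mem_Collect_eq by (intro disjI1 exI)
qed

text \<open>Over \<open>S\<close> the value is an injective code below the diagonal and 0 above it.
  \<open>Suc\<close> keeps the ranges apart, so the function is canonical with an injective
  half.\<close>

lemma tree_fun_branch_not_T2:
  assumes "branch S" "S \<subseteq> N"
  shows "tree_fun N \<notin> T2"
proof -
  have D: "tree_fun N (x, y) = Suc (prod_encode (x, y))" if "(x, y) \<in> Delta S S" for x y
    using assms that by (auto simp: branch_def tree_fun_def Delta_def)
  have N: "tree_fun N (x, y) = 0" if "(x, y) \<in> Nabla S S" for x y
    using that strict_suffix_imp_less[of y x] by (auto simp: tree_fun_def Nabla_def)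
  have inj: "inj_on (tree_fun N) (Delta S S)"
    using D by (intro inj_onI) auto
  moreover have "canonical S S (Nabla S S) (tree_fun N)"
    unfolding canonical_def by (intro disjI1 exI[of _ 0]) (use N in auto)
  moreover have "tree_fun N ` Delta S S \<inter> tree_fun N ` Nabla S S = {}"
    using D N by fastforce
  ultimately have "canonical_on (tree_fun N) S S"
    using assms(1) unfolding canonical_on_def canonical_def[of _ _ "Delta _ _"] branch_def by blast
  with inj show ?thesis unfolding T2_def nowhere_injective_def by blast
qed

text \<open>After thinning, \<open>f\<close> and \<open>g\<close> are canonical on the lower
  triangle, and \<open>T2\<close> excludes the injective type, so each depends on at most one index;
  an injective composite forces different indices. If \<open>f\<close> follows the smaller index, a
  single node has infinitely many initial segments; if \<open>g\<close> does, its values form a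
  branch.\<close>

lemma tree_fun_comp_not_inj_Delta:
  assumes no_branch: "\<And>S. S \<subseteq> N \<Longrightarrow> \<not> branch S"
    and T2: "f \<in> T2" "g \<in> T2" and inf: "infinite S1" "infinite S2"
  shows "\<not> inj_on (\<lambda>p. tree_fun N (f p, g p)) (Delta S1 S2)"
proof
  assume inj: "inj_on (\<lambda>p. tree_fun N (f p, g p)) (Delta S1 S2)"
  obtain a b where ab: "interleaved a b" and sub: "range a \<subseteq> S1" "range b \<subseteq> S2"
    using obtain_interleaved[OF inf] .
  obtain d where d: "strict_mono d"
    and canon_f: "canonical_pairs (\<lambda>j i. f (a (d i), b (d j)))"
    using Erdos_Rado_pairs[of "\<lambda>j i. f (a i, b j)"] by blast
  obtain e where e: "strict_mono e"
    and canon_q: "canonical_pairs (\<lambda>j i. g (a (d (e i)), b (d (e j))))"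
    using Erdos_Rado_pairs[of "\<lambda>j i. g (a (d i), b (d j))"] by blast
  define x where "x i = a (d (e i))" for i
  define y where "y j = b (d (e j))" for j
  have xy: "interleaved x y"
    unfolding x_def y_def by (rule interleaved_subsequence[OF interleaved_subsequence[OF ab d] e])
  define p where "p j i = f (x i, y j)" for i j
  define q where "q j i = g (x i, y j)" for i j
  have p: "canonical_pairs p"
    using canonical_pairs_subsequence[OF canon_f e] unfolding p_def x_def y_def .
  have q: "canonical_pairs q"
    using canon_q unfolding q_def x_def y_def .
  have np: "\<not> inj_on (\<lambda>(j, i). p j i) {(j, i). j < i}"
    using T2_not_inj_lower[OF T2(1) xy] unfolding p_def .
  have nq: "\<not> inj_on (\<lambda>(j, i). q j i) {(j, i). j < i}"
    using T2_not_inj_lower[OF T2(2) xy] unfolding q_def .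
  define k where "k j i = tree_fun N (p j i, q j i)" for j i
  have k: "j = j' \<and> i = i'" if "j < i" "j' < i'" "k j i = k j' i'" for i j i' j'
  proof -
    have "(x i, y j) \<in> Delta S1 S2" if "j < i" for i j
      using that sub interleaved_less(4)[OF xy] by (auto simp: Delta_def x_def y_def)
    then have "(x i, y j) = (x i', y j')"
      using that by (intro inj_onD[OF inj]) (simp_all add: k_def p_def q_def)
    then show ?thesis
      using interleaved_less(1,2)[OF xy] by (simp add: strict_mono_eq)
  qed
  \<comment> \<open>By injectivity the value 0 occurs at most once, so it disappears beyond some
    \<open>m\<close>.\<close>
  have "\<exists>m. \<forall>j i. m \<le> j \<longrightarrow> j < i \<longrightarrow> k j i \<noteq> 0"
  proof (rule ccontr)
    assume "\<not> ?thesis"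
    then have zero: "\<forall>m. \<exists>j i. m \<le> j \<and> j < i \<and> k j i = 0"
      by (simp only: not_ex not_all not_imp not_not simp_thms)
    obtain j i where "j < i" "k j i = 0" using zero by blast
    moreover obtain j' i' where "Suc j \<le> j'" "j' < i'" "k j' i' = 0" using zero by blast
    ultimately show False using k[of j i j' i'] by simp
  qed
  then obtain m where m: "\<And>j i. m \<le> j \<Longrightarrow> j < i \<Longrightarrow> k j i \<noteq> 0" by blast
  have suf: "strict_suffix (list_decode (q j i)) (list_decode (p j i))" and in_N: "q j i \<in> N"
    if "m \<le> j" "j < i" for i j
    using m[OF that] by (auto simp: k_def tree_fun_def split: if_splits)
  \<comment> \<open>\<open>p\<close> and \<open>q\<close> cannot both ignore the larger index
    (\<open>k1\<close>), nor both the smaller one (\<open>k2\<close>).\<close>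
  have k1: "\<not> (p 0 1 = p 0 2 \<and> q 0 1 = q 0 2)" using k[of 0 1 0 2] by (auto simp: k_def)
  have k2: "\<not> (p 0 2 = p 1 2 \<and> q 0 2 = q 1 2)" using k[of 0 2 1 2] by (auto simp: k_def)
  from p[unfolded canonical_pairs_def] np
  consider (P0) c where "\<And>j i. j < i \<Longrightarrow> p j i = c"
    | (P1) G where "inj G" "\<And>j i. j < i \<Longrightarrow> p j i = G j"
    | (P2) G where "inj G" "\<And>j i. j < i \<Longrightarrow> p j i = G i" by metis
  note P = this
  from q[unfolded canonical_pairs_def] nq
  consider (Q0) c where "\<And>j i. j < i \<Longrightarrow> q j i = c"
    | (Q1) G where "inj G" "\<And>j i. j < i \<Longrightarrow> q j i = G j"
    | (Q2) G where "inj G" "\<And>j i. j < i \<Longrightarrow> q j i = G i" by metis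
  then show False
  proof cases
    case Q0
    from P show False by cases (use Q0 k1 k2 in simp_all)
  next
    case Q1
    from P show False
    proof cases
      case (P2 F)
      let ?S = "G ` {m..}"
      have "G i \<in> N" if "m \<le> i" for i
        using in_N[of i "Suc i"] Q1(2)[of i "Suc i"] that by simp
      then have "?S \<subseteq> N" by auto
      moreover have "branch ?S"
        unfolding branch_def
      proof (intro conjI ballI impI)
        show "infinite ?S"
          using finite_imageD[of G "{m..}"] inj_on_subset[OF Q1(1)] infinite_Ici by blast
        fix u v assume uv: "u \<in> ?S" "v \<in> ?S" "v < u"
        then obtain i j where ij: "u = G i" "v = G j" "m \<le> i" "m \<le> j" by auto
        \<comment> \<open>For \<open>l\<close> beyond both indices, both sequences are initial
          segments of the one coded by \<open>F l\<close>, hence comparable.\<close>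
        define l where "l = Suc (max i j)"
        have "suffix (list_decode u) (list_decode (F l))" "suffix (list_decode v) (list_decode (F l))"
          using suf[of i l] suf[of j l] ij Q1(2)[of i l] Q1(2)[of j l] P2(2)[of i l] P2(2)[of j l]
          by (simp_all add: l_def strict_suffix_def)
        then have "suffix (list_decode u) (list_decode v) \<or> suffix (list_decode v) (list_decode u)"
          by (rule suffix_same_cases)
        moreover have "\<not> suffix (list_decode u) (list_decode v)"
          using suffix_imp_list_encode_le[of "list_decode u" "list_decode v"] uv(3) by auto
        ultimately show "strict_suffix (list_decode v) (list_decode u)"
          by (auto simp: strict_suffix_def)
      qed
      ultimately show False using no_branch by blast
    qed (use Q1 k1 in simp_all)
  next
    case Q2
    from P show False
    proof cases
      case (P1 F)
      \<comment> \<open>Initial segments have smaller codes, so the injective \<open>G\<close> would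
        take infinitely many values below \<open>F m\<close>.\<close>
      have "G i < F m" if "m < i" for i
        using suf[of m i] that P1(2)[of m i] Q2(2)[of m i] strict_suffix_imp_less by simp
      then have "G ` {m<..} \<subseteq> {..<F m}" by auto
      then have "finite (G ` {m<..})" by (rule finite_subset) simp
      then show False
        using finite_imageD[of G "{m<..}"] inj_on_subset[OF Q2(1)] infinite_Ioi by blast
    qed (use Q2 k2 in simp_all)
  qed
qed

lemma tree_fun_comp_in_T2:
  assumes no_branch: "\<And>S. S \<subseteq> N \<Longrightarrow> \<not> branch S" and T2: "f \<in> T2" "g \<in> T2"
  shows "(\<lambda>p. tree_fun N (f p, g p)) \<in> T2"
proof -
  have "\<not> inj_on (\<lambda>p. tree_fun N (f p, g p)) (Delta S1 S2) \<and>
      \<not> inj_on (\<lambda>p. tree_fun N (f p, g p)) (Nabla S1 S2)"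
    if "infinite S1" "infinite S2" for S1 S2
  proof
    show "\<not> inj_on (\<lambda>p. tree_fun N (f p, g p)) (Delta S1 S2)"
      by (rule tree_fun_comp_not_inj_Delta[OF no_branch T2 that])
    have "\<not> inj_on (\<lambda>p. tree_fun N (f (prod.swap p), g (prod.swap p))) (Delta S2 S1)"
      by (rule tree_fun_comp_not_inj_Delta[OF no_branch T2[THEN T2_swap] that(2,1)])
    then show "\<not> inj_on (\<lambda>p. tree_fun N (f p, g p)) (Nabla S1 S2)"
      by (simp add: Delta_Nabla_swap(2)[of S1 S2] inj_on_swap)
  qed
  then show ?thesis unfolding T2_def nowhere_injective_def canonical_on_def by simp
qed

section \<open>The diagonal construction\<close>

lemma course_of_values_set:
  fixes P :: "nat \<Rightarrow> nat set \<Rightarrow> bool"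
  shows "\<exists>N. \<forall>z. z \<in> N \<longleftrightarrow> P z (N \<inter> {..<z})"
proof -
  \<comment> \<open>\<open>A z\<close> collects the members below \<open>z\<close>, which
    \<open>P\<close> may consult about \<open>z\<close>.\<close>
  define A where "A = rec_nat {} (\<lambda>z X. if P z X then insert z X else X)"
  define N where "N = {z. P z (A z)}"
  have mem: "z \<in> N \<longleftrightarrow> P z (A z)" for z by (simp add: N_def)
  have A: "A 0 = {}" "A (Suc z) = (if z \<in> N then insert z (A z) else A z)" for z
    unfolding mem by (simp_all add: A_def)
  have "A z = N \<inter> {..<z}" for z
    by (induction z) (simp_all add: A lessThan_Suc)
  then have "\<forall>z. z \<in> N \<longleftrightarrow> P z (N \<inter> {..<z})" by (simp add: mem)
  then show ?thesis ..
qed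

text \<open>Continuity from the Baire space into the binary functions with pointwise
  convergence.\<close>

definition continuous_param :: "((nat \<Rightarrow> nat) \<Rightarrow> binop) \<Rightarrow> bool" where
  "continuous_param \<Phi> \<longleftrightarrow>
     (\<forall>w p. \<exists>n. \<forall>w'. (\<forall>i<n. w' i = w i) \<longrightarrow> \<Phi> w' p = \<Phi> w p)"

lemma diagonal_tree_fun:
  assumes cont: "continuous_param \<Phi>" and range: "range \<Phi> \<subseteq> T2"
  obtains N where "tree_fun N \<notin> range \<Phi>" "\<And>S. S \<subseteq> N \<Longrightarrow> \<not> branch S"
proof -
  \<comment> \<open>\<open>rev\<close>, because sequences are stored from the last entry to the
    first.\<close>
  define agree where "agree z w \<longleftrightarrow> (\<forall>i<length (list_decode z). w i = rev (list_decode z) ! i)"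
    for z and w :: "nat \<Rightarrow> nat"
  obtain N where N: "\<And>z. z \<in> N \<longleftrightarrow> (\<exists>w. agree z w \<and>
      (\<forall>x<length (list_decode z). \<forall>y<length (list_decode z).
        \<Phi> w (x, y) = tree_fun (N \<inter> {..<z}) (x, y)))"
    using course_of_values_set[of "\<lambda>z X. \<exists>w. agree z w \<and>
      (\<forall>x<length (list_decode z). \<forall>y<length (list_decode z). \<Phi> w (x, y) = tree_fun X (x, y))"]
    by blast
  \<comment> \<open>This closes the self-reference: at coordinates below the length of
    \<open>z\<close>, the nodes below \<open>z\<close> already determine the final tree
    function.\<close>
  have restrict: "tree_fun (N \<inter> {..<z}) (x, y) = tree_fun N (x, y)"
    if "x < length (list_decode z)" "y < length (list_decode z)" for x y z
    using that length_list_decode_le[of z] by (simp add: tree_fun_def)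
  have N: "z \<in> N \<longleftrightarrow> (\<exists>w. agree z w \<and>
      (\<forall>x<length (list_decode z). \<forall>y<length (list_decode z). \<Phi> w (x, y) = tree_fun N (x, y)))" for z
    unfolding N[of z] by (simp add: restrict cong: conj_cong)
  show thesis
  proof (rule that)
    show "tree_fun N \<notin> range \<Phi>"
    proof
      assume "tree_fun N \<in> range \<Phi>"
      then obtain w where w: "\<Phi> w = tree_fun N" by auto
      \<comment> \<open>\<open>s n\<close> codes the first \<open>n\<close> entries of
        \<open>w\<close>, and \<open>w\<close> itself witnesses that it is a node.\<close>
      define s where "s n = list_encode (rev (map w [0..<n]))" for n
      have suf: "strict_suffix (list_decode (s n)) (list_decode (s m))" if "n < m" for n m
        using that upt_add_eq_append[of 0 n "m - n"]
        by (auto simp: s_def strict_suffix_def suffix_def dest: arg_cong[of _ _ length])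
      then have less: "s n < s m" if "n < m" for n m
        using that strict_suffix_imp_less by blast
      then have mono: "strict_mono s" by (simp add: strict_mono_def)
      have "branch (range s)"
        using suf by (auto simp: branch_def range_inj_infinite strict_mono_imp_inj_on[OF mono]
            strict_mono_less[OF mono])
      moreover have "s n \<in> N" for n
        unfolding N by (intro exI[of _ w]) (simp add: agree_def s_def w rev_nth)
      ultimately have "tree_fun N \<notin> T2" by (intro tree_fun_branch_not_T2) auto
      with \<open>tree_fun N \<in> range \<Phi>\<close> range show False by blast
    qed
    fix S assume "S \<subseteq> N"
    show "\<not> branch S"
    proof
      assume S: "branch S"
      let ?l = "\<lambda>z. length (list_decode z)"
      have suf: "strict_suffix (list_decode y) (list_decode x)" if "x \<in> S" "y \<in> S" "y < x" for x y
        using S that by (simp add: branch_def)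
      \<comment> \<open>Lengths are distinct along the chain, hence unbounded, so every entry of the
        limit sequence can be read off some member of \<open>S\<close>.\<close>
      have "inj_on ?l S"
        by (rule linorder_inj_onI) (use suf suffix_length_less in fastforce)+
      then have "infinite (?l ` S)" using S finite_imageD unfolding branch_def by blast
      then have "\<exists>z. z \<in> S \<and> n < ?l z" for n
        unfolding infinite_nat_iff_unbounded by blast
      then obtain Z where Z: "\<And>n. Z n \<in> S" "\<And>n. n < ?l (Z n)" by metis
      define w where "w n = rev (list_decode (Z n)) ! n" for n
      have pre: "rev (list_decode y) ! i = rev (list_decode x) ! i"
        if "x \<in> S" "y \<in> S" "i < ?l x" "i < ?l y" "y < x" for x y i
        using suf[of x y] that by (auto simp: strict_suffix_def suffix_def nth_append)
      have w: "rev (list_decode z) ! i = w i" if "z \<in> S" "i < ?l z" for z i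
      proof (cases z "Z i" rule: linorder_cases)
        case less
        then show ?thesis unfolding w_def using pre[of "Z i" z i] Z[of i] that by simp
      next
        case equal
        then show ?thesis unfolding w_def by simp
      next
        case greater
        then show ?thesis unfolding w_def using pre[of z "Z i" i] Z[of i] that by simp
      qed
      have "\<Phi> w (x, y) = tree_fun N (x, y)" for x y
      proof -
        obtain n where n: "\<forall>w'. (\<forall>i<n. w' i = w i) \<longrightarrow> \<Phi> w' (x, y) = \<Phi> w (x, y)"
          using cont unfolding continuous_param_def by blast
        \<comment> \<open>A member of \<open>S\<close> longer than the modulus \<open>n\<close> and
          both coordinates; its witness \<open>w'\<close> agrees with \<open>w\<close> below
          \<open>n\<close>.\<close>
        define z where "z = Z (max n (max x y))"
        have z: "z \<in> S" "n < ?l z" "x < ?l z" "y < ?l z"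
          using Z[of "max n (max x y)"] by (simp_all add: z_def)
        with \<open>S \<subseteq> N\<close> obtain w' where "agree z w'" and w': "\<Phi> w' (x, y) = tree_fun N (x, y)"
          using N[of z] by blast
        then have "\<forall>i<n. w' i = w i" using w[OF z(1)] z(2) by (simp add: agree_def)
        with n have "\<Phi> w' (x, y) = \<Phi> w (x, y)" by blast
        with w' show ?thesis by (simp only:)
      qed
      then have "\<Phi> w = tree_fun N" by auto
      moreover have "tree_fun N \<notin> T2" by (rule tree_fun_branch_not_T2[OF S \<open>S \<subseteq> N\<close>])
      ultimately show False using subsetD[OF range rangeI[of \<Phi> w]] by simp
    qed
  qed
qed

section \<open>Generation by countably many operations\<close>

text \<open>\<open>Table a t\<close> applies a unary function known only by its label
  \<open>a\<close>. So terms with labels in \<open>nat\<close> are countable, and the uncountable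
  choice of functions is left to \<open>u\<close> in \<open>eval\<close>.\<close>

datatype 'a tm = Var1 | Var2 | Table 'a "'a tm" | App nat "'a tm list"

instance tm :: (countable) countable
  by countable_datatype

primrec eval :: "(nat \<Rightarrow> operation) \<Rightarrow> (nat \<Rightarrow> nat \<Rightarrow> nat) \<Rightarrow> nat tm \<Rightarrow> binop" where
  "eval c u Var1 = fst"
| "eval c u Var2 = snd"
| "eval c u (Table a t) = (\<lambda>p. u a (eval c u t p))"
| "eval c u (App m ts) = (\<lambda>p. snd (c m) (map (\<lambda>h. h p) (map (eval c u) ts)))"

definition generated :: "(nat \<Rightarrow> operation) \<Rightarrow> binop set" where
  "generated c = {eval c u t | u t. True}"

definition unary_closed :: "binop set \<Rightarrow> bool" where
  "unary_closed B \<longleftrightarrow> (\<forall>u. \<forall>h\<in>B. (\<lambda>p. u (h p)) \<in> B)"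

lemma unary_closedD: "unary_closed B \<Longrightarrow> h \<in> B \<Longrightarrow> (\<lambda>p. u (h p)) \<in> B"
  by (simp add: unary_closed_def)

lemma Pol_iff:
  assumes "f \<in> ops k" "1 \<le> k"
  shows "f \<in> Pol B \<longleftrightarrow>
    (\<forall>gs. length gs = k \<and> set gs \<subseteq> B \<longrightarrow> (\<lambda>p. snd f (map (\<lambda>g. g p) gs)) \<in> B)"
proof -
  define P where "P j \<longleftrightarrow> (\<forall>gs. length gs = j \<and> set gs \<subseteq> B \<longrightarrow> (\<lambda>p. snd f (map (\<lambda>g. g p) gs)) \<in> B)" for j
  have "f \<in> Pol B \<longleftrightarrow> (\<exists>j\<ge>1. f \<in> ops j \<and> P j)" unfolding Pol_def P_def by blast
  moreover have "j = k" if "f \<in> ops j" for j using assms(1) that by (auto simp: ops_def)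
  ultimately have "f \<in> Pol B \<longleftrightarrow> P k" using assms by blast
  then show ?thesis by (simp only: P_def)
qed

text \<open>Terms do not check arities, so argument lists of every length must be allowed.\<close>

lemma Pol_apply:
  assumes "f \<in> Pol B" "unary_closed B" "B \<noteq> {}" "set hs \<subseteq> B"
  shows "(\<lambda>p. snd f (map (\<lambda>h. h p) hs)) \<in> B"
proof -
  obtain k where k: "f \<in> ops k"
    and closed: "\<And>gs. length gs = k \<and> set gs \<subseteq> B \<longrightarrow> (\<lambda>p. snd f (map (\<lambda>g. g p) gs)) \<in> B"
    using assms(1) unfolding Pol_def by blast
  show ?thesis
  proof (cases "length hs = k")
    case True
    with closed assms(4) show ?thesis by simp
  next
    case False
    \<comment> \<open>Off its arity an operation has the constant value \<open>undefined\<close>.\<close>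
    have "snd f (map (\<lambda>h. h p) hs) = undefined" for p
      using k False by (auto simp: ops_def PiE_def extensional_def)
    moreover obtain h where "h \<in> B" using assms(3) by blast
    then have "(\<lambda>p. undefined) \<in> B" by (rule unary_closedD[OF assms(2)])
    ultimately show ?thesis by simp
  qed
qed

text \<open>With projections for \<open>g\<close> and \<open>h\<close> this places all generated
  functions in \<open>B\<close>; with \<open>B = generated c\<close> it gives closure under
  composition.\<close>

lemma eval_in:
  assumes "range c \<subseteq> Pol B" "unary_closed B" "g \<in> B" "h \<in> B"
  shows "(\<lambda>p. eval c u t (g p, h p)) \<in> B"
proof (induction t)
  case (Table a t)
  from unary_closedD[OF assms(2) this] show ?case by simp
next
  case (App m ts)
  have "(\<lambda>p. snd (c m) (map (\<lambda>k. k p) (map (\<lambda>t p. eval c u t (g p, h p)) ts))) \<in> B"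
    using assms App by (intro Pol_apply) auto
  then show ?case by (simp add: comp_def)
qed (use assms in simp_all)

lemma eval_map_tm: "eval c u (map_tm \<phi> t) = eval c (\<lambda>a. u (\<phi> a)) t"
  by (induction t) (simp_all add: comp_def cong: map_cong)

lemma fst_snd_generated: "fst \<in> generated c" "snd \<in> generated c"
  unfolding generated_def by (metis (mono_tags, lifting) CollectI eval.simps(1,2))+

lemma unary_closed_generated: "unary_closed (generated c)"
  unfolding unary_closed_def
proof (intro allI ballI)
  fix v h assume "h \<in> generated c"
  then obtain u t where h: "h = eval c u t" by (auto simp: generated_def)
  \<comment> \<open>The new function takes label 0, and the old labels move up by one.\<close>
  have "(\<lambda>p. v (h p)) = eval c (case_nat v u) (Table 0 (map_tm Suc t))"
    by (simp add: eval_map_tm h)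
  then show "(\<lambda>p. v (h p)) \<in> generated c" unfolding generated_def by blast
qed

lemma range_subset_Pol_generated:
  assumes "range c \<subseteq> all_ops"
  shows "range c \<subseteq> Pol (generated c)"
proof (intro image_subsetI)
  fix m
  obtain k where k: "k \<ge> 1" "c m \<in> ops k"
    using assms by (auto simp: all_ops_def)
  have "(\<lambda>p. snd (c m) (map (\<lambda>g. g p) gs)) \<in> generated c"
    if gs: "length gs = k" "set gs \<subseteq> generated c" for gs
  proof -
    have "\<forall>i\<in>{..<k}. \<exists>u t. gs ! i = eval c u t"
      using gs by (force simp: generated_def dest: nth_mem)
    then obtain U T where UT: "\<And>i. i < k \<Longrightarrow> gs ! i = eval c (U i) (T i)" by (metis lessThan_iff)
    \<comment> \<open>Pairing each label with the index of its term keeps the labels of the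
      \<open>k\<close> terms apart, so one family of tables serves them all.\<close>
    define u where "u a = (case prod_decode a of (i, a') \<Rightarrow> U i a')" for a
    define ts where "ts = map (\<lambda>i. map_tm (\<lambda>a. prod_encode (i, a)) (T i)) [0..<k]"
    have "map (eval c u) ts = gs"
      using gs(1) UT by (intro nth_equalityI) (simp_all add: ts_def eval_map_tm u_def)
    then have "(\<lambda>p. snd (c m) (map (\<lambda>g. g p) gs)) = eval c u (App m ts)" by simp
    then show ?thesis unfolding generated_def by blast
  qed
  then show "c m \<in> Pol (generated c)" using Pol_iff[OF k(2,1)] by blast
qed

lemma binary_clone_generated:
  assumes "range c \<subseteq> all_ops"
  shows "binary_clone (generated c)"
proof -
  have "(\<lambda>p. f (g p, h p)) \<in> generated c"
    if "f \<in> generated c" "g \<in> generated c" "h \<in> generated c" for f g h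
  proof -
    obtain u t where "f = eval c u t" using \<open>f \<in> generated c\<close> by (auto simp: generated_def)
    then show ?thesis
      using eval_in[OF range_subset_Pol_generated[OF assms] unary_closed_generated that(2,3)] by simp
  qed
  with fst_snd_generated show ?thesis by (simp add: binary_clone_def)
qed

text \<open>One sequence carries a term and all its tables: entry 0 is reserved for the code of the
  term, hence the \<open>Suc\<close>.\<close>

definition tables :: "(nat \<Rightarrow> nat) \<Rightarrow> nat \<Rightarrow> nat \<Rightarrow> nat" where
  "tables w a x = w (Suc (prod_encode (a, x)))"

definition param :: "(nat \<Rightarrow> operation) \<Rightarrow> (nat \<Rightarrow> nat) \<Rightarrow> binop" where
  "param c w = eval c (tables w) (from_nat (w 0))"

lemma range_param: "range (param c) = generated c"
proof -
  have "eval c u t \<in> range (param c)" for u t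
  proof -
    define w where "w = case_nat (to_nat t) (\<lambda>n. case prod_decode n of (a, x) \<Rightarrow> u a x)"
    have "tables w = u" by (intro ext) (simp add: tables_def w_def)
    then have "param c w = eval c u t" by (simp add: param_def w_def)
    then show ?thesis by (metis rangeI)
  qed
  then show ?thesis by (auto simp: generated_def param_def)
qed

text \<open>Evaluation at one point looks up only finitely many table entries.\<close>

lemma eval_tables_continuous:
  "\<exists>n. \<forall>w'. (\<forall>i<n. w' i = w i) \<longrightarrow> eval c (tables w') t p = eval c (tables w) t p"
proof (induction t)
  case (Table a t)
  then obtain n where n: "\<forall>w'. (\<forall>i<n. w' i = w i) \<longrightarrow> eval c (tables w') t p = eval c (tables w) t p"
    by blast
  \<comment> \<open>The one further entry consulted once the argument of the table is known.\<close>
  define m where "m = Suc (prod_encode (a, eval c (tables w) t p))"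
  have "eval c (tables w') (Table a t) p = eval c (tables w) (Table a t) p"
    if w': "\<forall>i<max n (Suc m). w' i = w i" for w'
  proof -
    have "eval c (tables w') t p = eval c (tables w) t p" using n[rule_format, of w'] w' by simp
    moreover have "w' m = w m" using w' by simp
    ultimately show ?thesis by (simp add: tables_def m_def)
  qed
  then show ?case by blast
next
  case (App m ts)
  have "\<exists>n. \<forall>t\<in>set ts'. \<forall>w'. (\<forall>i<n. w' i = w i) \<longrightarrow>
      eval c (tables w') t p = eval c (tables w) t p" if "set ts' \<subseteq> set ts" for ts'
    using that
  proof (induction ts')
    case (Cons t ts')
    then obtain n1 where n1: "\<forall>t\<in>set ts'. \<forall>w'. (\<forall>i<n1. w' i = w i) \<longrightarrow>
        eval c (tables w') t p = eval c (tables w) t p" by auto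
    have "t \<in> set ts" using Cons.prems by simp
    from App.IH[OF this] obtain n2 where n2: "\<forall>w'. (\<forall>i<n2. w' i = w i) \<longrightarrow>
        eval c (tables w') t p = eval c (tables w) t p" by blast
    show ?case
    proof (intro exI[of _ "max n1 n2"] ballI allI impI)
      fix s w' assume "s \<in> set (t # ts')" and w': "\<forall>i<max n1 n2. w' i = w i"
      then consider "s = t" | "s \<in> set ts'" by auto
      then show "eval c (tables w') s p = eval c (tables w) s p"
        by cases (use n1 n2 w' less_max_iff_disj in metis)+
    qed
  qed simp
  then obtain n where n: "\<forall>t\<in>set ts. \<forall>w'. (\<forall>i<n. w' i = w i) \<longrightarrow>
      eval c (tables w') t p = eval c (tables w) t p" by blast
  have "eval c (tables w') (App m ts) p = eval c (tables w) (App m ts) p"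
    if "\<forall>i<n. w' i = w i" for w'
  proof -
    have "map (\<lambda>t. eval c (tables w') t p) ts = map (\<lambda>t. eval c (tables w) t p) ts"
      using n that by (intro map_cong) blast+
    then show ?thesis by (simp add: comp_def del: map_eq_conv)
  qed
  then show ?case by blast
qed simp_all

lemma continuous_param_param: "continuous_param (param c)"
  unfolding continuous_param_def
proof (intro allI)
  fix w p
  obtain n where n: "\<forall>w'. (\<forall>i<n. w' i = w i) \<longrightarrow>
      eval c (tables w') (from_nat (w 0)) p = eval c (tables w) (from_nat (w 0)) p"
    using eval_tables_continuous by blast
  show "\<exists>n. \<forall>w'. (\<forall>i<n. w' i = w i) \<longrightarrow> param c w' p = param c w p"
  \<comment> \<open>\<open>Suc n\<close> makes entry 0 agree as well, so both sequences code the
    same term.\<close>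
  proof (intro exI[of _ "Suc n"] allI impI)
    fix w' assume w': "\<forall>i<Suc n. w' i = w i"
    then have "eval c (tables w') (from_nat (w 0)) p = eval c (tables w) (from_nat (w 0)) p"
      by (intro n[rule_format]) simp
    moreover have "w' 0 = w 0" using w' by simp
    ultimately show "param c w' p = param c w p" by (simp add: param_def)
  qed
qed

section \<open>Polymorphism clones\<close>

lemma clone_Pol: "clone (Pol B)"
  unfolding clone_def
proof (intro conjI allI ballI impI)
  show "Pol B \<subseteq> all_ops" by (auto simp: Pol_def all_ops_def)
  fix n :: nat assume n: "1 \<le> n"
  show "projection n i \<in> Pol B" if "i < n" for i
  proof -
    have "projection n i \<in> ops n" by (simp add: projection_def ops_def)
    from Pol_iff[OF this n] show ?thesis using that by (auto simp: projection_def)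
  qed
  fix k f gs
  assume k: "1 \<le> k" and f: "f \<in> Pol B \<inter> ops n" and gs: "length gs = n \<and> set gs \<subseteq> Pol B \<inter> ops k"
  have g: "(\<lambda>p. snd g (map (\<lambda>h. h p) hs)) \<in> B"
    if "g \<in> set gs" "length hs = k" "set hs \<subseteq> B" for g hs
    using Pol_iff[of g k B] k gs that by blast
  have "(\<lambda>p. snd (op_comp k f gs) (map (\<lambda>h. h p) hs)) \<in> B" if hs: "length hs = k" "set hs \<subseteq> B" for hs
  proof -
    let ?gs = "map (\<lambda>g p. snd g (map (\<lambda>h. h p) hs)) gs"
    have "length ?gs = n" "set ?gs \<subseteq> B" using g hs gs by auto
    then have "(\<lambda>p. snd f (map (\<lambda>h. h p) ?gs)) \<in> B" using Pol_iff[of f n B] f n by blast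
    then show ?thesis using hs by (simp add: op_comp_def comp_def)
  qed
  moreover have "op_comp k f gs \<in> ops k" by (simp add: op_comp_def ops_def)
  ultimately show "op_comp k f gs \<in> Pol B" using Pol_iff k by blast
qed

definition binary_op :: "binop \<Rightarrow> operation" where
  "binary_op f = (2, restrict (\<lambda>xs. f (xs ! 0, xs ! 1)) {xs. length xs = 2})"

lemma binary_op_in_ops: "binary_op f \<in> ops 2"
  by (simp add: binary_op_def ops_def)

lemma binary_op_in_Pol_iff:
  "binary_op f \<in> Pol B \<longleftrightarrow> (\<forall>g\<in>B. \<forall>h\<in>B. (\<lambda>p. f (g p, h p)) \<in> B)"
proof
  assume f: "binary_op f \<in> Pol B"
  show "\<forall>g\<in>B. \<forall>h\<in>B. (\<lambda>p. f (g p, h p)) \<in> B"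
  proof (intro ballI)
    fix g h assume "g \<in> B" "h \<in> B"
    then have "length [g, h] = 2 \<and> set [g, h] \<subseteq> B" by simp
    then have "(\<lambda>p. snd (binary_op f) (map (\<lambda>g. g p) [g, h])) \<in> B"
      using f Pol_iff[OF binary_op_in_ops, of f B] by (simp only: one_le_numeral)
    then show "(\<lambda>p. f (g p, h p)) \<in> B" by (simp add: binary_op_def)
  qed
next
  assume f: "\<forall>g\<in>B. \<forall>h\<in>B. (\<lambda>p. f (g p, h p)) \<in> B"
  have "(\<lambda>p. snd (binary_op f) (map (\<lambda>g. g p) gs)) \<in> B" if gs: "length gs = 2" "set gs \<subseteq> B" for gs
  proof -
    obtain g h where "gs = [g, h]" using gs(1) by (auto simp: numeral_2_eq_2 length_Suc_conv)
    with f gs(2) show ?thesis by (simp add: binary_op_def)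
  qed
  then show "binary_op f \<in> Pol B" using Pol_iff[OF binary_op_in_ops, of f B] by simp
qed

lemma ops_1_subset_Pol_iff: "ops 1 \<subseteq> Pol B \<longleftrightarrow> unary_closed B"
proof
  assume sub: "ops 1 \<subseteq> Pol B"
  show "unary_closed B"
    unfolding unary_closed_def
  proof (intro allI ballI)
    fix u h assume "h \<in> B"
    define f :: operation where "f = (1, restrict (\<lambda>xs. u (xs ! 0)) {xs. length xs = 1})"
    have f: "f \<in> ops 1" by (simp add: f_def ops_def)
    moreover have "length [h] = 1 \<and> set [h] \<subseteq> B" using \<open>h \<in> B\<close> by simp
    ultimately have "(\<lambda>p. snd f (map (\<lambda>g. g p) [h])) \<in> B"
      using sub Pol_iff[OF f, of B] by blast
    then show "(\<lambda>p. u (h p)) \<in> B" by (simp add: f_def)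
  qed
next
  assume B: "unary_closed B"
  show "ops 1 \<subseteq> Pol B"
  proof
    fix f assume f: "f \<in> ops 1"
    have "(\<lambda>p. snd f (map (\<lambda>g. g p) gs)) \<in> B" if gs: "length gs = 1" "set gs \<subseteq> B" for gs
    proof -
      obtain h where "gs = [h]" using gs(1) by (auto simp: length_Suc_conv)
      with gs(2) show ?thesis using unary_closedD[OF B, of h] by simp
    qed
    then show "f \<in> Pol B" using Pol_iff[OF f] by simp
  qed
qed

text \<open>\<open>G\<close> collects what \<open>C\<close> and the unary functions generate. For
  binary clones the contradiction will come from \<open>g \<in> T1 \<inter> T2\<close>, for
  polymorphisms from \<open>binary_op g \<in> Pol T2\<close>.\<close>

lemma countable_generation_misses_T1_T2:
  assumes "countable C" "C \<subseteq> Pol B" "unary_closed B" "fst \<in> B" "snd \<in> B" "B \<subseteq> T2"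
  shows "\<exists>G g. binary_clone G \<and> unary_closed G \<and> C \<subseteq> Pol G \<and>
    g \<in> T1 \<inter> T2 \<and> g \<notin> G \<and> binary_op g \<in> Pol T2"
proof -
  \<comment> \<open>The projection makes the set nonempty, so that it is the range of a
    sequence.\<close>
  define c where "c = from_nat_into (insert (projection 1 0) C)"
  have range_c: "range c = insert (projection 1 0) C"
    unfolding c_def using assms(1) by (intro range_from_nat_into) simp_all
  have "projection 1 0 \<in> Pol B" using clone_Pol[of B] by (simp add: clone_def)
  with assms(2) have c_Pol: "range c \<subseteq> Pol B" by (simp add: range_c)
  also have "\<dots> \<subseteq> all_ops" using clone_Pol[of B] by (simp add: clone_def)
  finally have c: "range c \<subseteq> all_ops" .
  have "generated c \<subseteq> B"
    using eval_in[OF c_Pol assms(3-5)] by (auto simp: generated_def)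
  with assms(6) have "range (param c) \<subseteq> T2" by (simp add: range_param)
  then obtain N where N: "tree_fun N \<notin> range (param c)" "\<And>S. S \<subseteq> N \<Longrightarrow> \<not> branch S"
    using diagonal_tree_fun[OF continuous_param_param] by blast
  note comp = tree_fun_comp_in_T2[OF N(2)]
  show ?thesis
  proof (intro exI conjI)
    show "binary_clone (generated c)" by (rule binary_clone_generated[OF c])
    show "unary_closed (generated c)" by (rule unary_closed_generated)
    show "C \<subseteq> Pol (generated c)" using range_subset_Pol_generated[OF c] by (simp add: range_c)
    show "tree_fun N \<in> T1 \<inter> T2"
      using tree_fun_in_T1 comp[OF _ projections_in_T2] by simp
    show "tree_fun N \<notin> generated c" using N(1) by (simp add: range_param)
    show "binary_op (tree_fun N) \<in> Pol T2"
      unfolding binary_op_in_Pol_iff using comp by blast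
  qed
qed

section \<open>No countable generation\<close>

lemma binary_clone_hull: "binary_clone (binary_clone hull B)"
  by (rule hull_in) (auto simp: binary_clone_def)

lemma binary_unary_subset_imp_unary_closed:
  assumes "binary_clone D" "binary_unary \<subseteq> D"
  shows "unary_closed D"
  unfolding unary_closed_def
proof (intro allI ballI)
  fix u h assume "h \<in> D"
  moreover have "(\<lambda>(x, y). u x) \<in> D" using assms(2) by (auto simp: binary_unary_def)
  ultimately have "(\<lambda>p. (\<lambda>(x, y). u x) (h p, h p)) \<in> D"
    using assms(1) unfolding binary_clone_def by blast
  then show "(\<lambda>p. u (h p)) \<in> D" by simp
qed

text \<open>\<open>G\<close> is a binary clone containing the generators, so
  \<open>D \<subseteq> G\<close>, whereas \<open>g\<close> lies in \<open>D\<close> and not in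
  \<open>G\<close>. Both \<open>T2\<close> and \<open>T1 \<inter> T2\<close> are instances.\<close>

lemma not_countably_generated_binary:
  assumes "countable C" "T1 \<inter> T2 \<subseteq> D" "D \<subseteq> T2"
  shows "D \<noteq> binary_clone hull (C \<union> binary_unary)"
proof
  assume D: "D = binary_clone hull (C \<union> binary_unary)"
  have clone: "binary_clone D" unfolding D by (rule binary_clone_hull)
  have sub: "C \<union> binary_unary \<subseteq> D" unfolding D by (rule hull_subset)
  have "binary_op ` C \<subseteq> Pol D"
    using clone sub by (auto simp: binary_op_in_Pol_iff binary_clone_def)
  moreover have "unary_closed D"
    using binary_unary_subset_imp_unary_closed clone sub by simp
  moreover have "fst \<in> D" "snd \<in> D" using clone by (simp_all add: binary_clone_def)
  ultimately obtain G g where G: "binary_clone G" "unary_closed G" "binary_op ` C \<subseteq> Pol G"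
    and g: "g \<in> T1 \<inter> T2" "g \<notin> G"
    using countable_generation_misses_T1_T2[of "binary_op ` C" D] assms(1,3) by blast
  have proj: "fst \<in> G" "snd \<in> G" using G(1) by (simp_all add: binary_clone_def)
  have "f \<in> G" if "f \<in> C" for f
  proof -
    have "(\<lambda>p. f (fst p, snd p)) \<in> G" using G(3) proj that binary_op_in_Pol_iff by blast
    then show ?thesis by simp
  qed
  moreover have "binary_unary \<subseteq> G"
    using proj[THEN unary_closedD[OF G(2)]] by (auto simp: binary_unary_def case_prod_unfold)
  ultimately have "D \<subseteq> G" unfolding D using G(1) by (intro hull_minimal) auto
  with g assms(2) show False by blast
qed

text \<open>\<open>Pol G\<close> is a clone containing the generators, hence all of
  \<open>Pol T2\<close>; applying \<open>binary_op g\<close> to the projections would then put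
  \<open>g\<close> into \<open>G\<close>.\<close>

lemma not_countably_generated_Pol_T2:
  assumes "countable C"
  shows "Pol T2 \<noteq> clone hull (C \<union> ops 1)"
proof
  assume D: "Pol T2 = clone hull (C \<union> ops 1)"
  then have "C \<union> ops 1 \<subseteq> Pol T2" by (simp only: hull_subset)
  then obtain G g where G: "binary_clone G" "unary_closed G" "C \<subseteq> Pol G"
    and g: "g \<notin> G" "binary_op g \<in> Pol T2"
    using countable_generation_misses_T1_T2[OF assms, of T2] projections_in_T2 ops_1_subset_Pol_iff
    by blast
  have "Pol T2 \<subseteq> Pol G"
    unfolding D using G(2,3) ops_1_subset_Pol_iff by (intro hull_minimal clone_Pol) blast
  with g(2) have "binary_op g \<in> Pol G" by blast
  moreover have "fst \<in> G" "snd \<in> G" using G(1) by (simp_all add: binary_clone_def)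
  ultimately have "(\<lambda>p. g (fst p, snd p)) \<in> G" unfolding binary_op_in_Pol_iff by blast
  with g(1) show False by simp
qed

theorem mainTheorem5:
  "\<not> (\<exists>C. C \<subseteq> all_ops \<and> countable C \<and> Pol T2 = clone hull (C \<union> ops 1)) \<and>
   \<not> (\<exists>C. countable C \<and> T2 = binary_clone hull (C \<union> binary_unary)) \<and>
   \<not> (\<exists>C. countable C \<and> T1 \<inter> T2 = binary_clone hull (C \<union> binary_unary))"
  using not_countably_generated_Pol_T2 not_countably_generated_binary by auto

end
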